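(* Let $f\colon(\{0,1\}^n,\mu_p)\to\{0,1\}$ be intersecting and assume $1/\sqrt{m(f)}\le p\le1/2$. Then $\mu_p(f)\le32\exp(-0.0001/p)$.
   Context: $\mu_p$ is the $p$-biased product measure on $\{0,1\}^n$ and $\mu_p(f)=\mathbb{E}_{\mu_p}[f]$. Subsets of $[n]$ are identified with points of $\{0,1\}^n$; $f$ is intersecting if $A\cap B\ne\emptyset$ whenever $f(A)=f(B)=1$. With $\chi_i(x)=\frac{x_i-p}{\sqrt{p(1-p)}}$, $\hat f(\{i\})=\mathbb{E}_{\mu_p}[f\chi_i]$; $\delta=\max_i|\hat f(\{i\})|$ and $m(f)=|\{i:\hat f(\{i\})^2\ge\delta^2/2\}|$. *)

theory Defs
  imports Complex_Main
begin

text \<open>Points of {0,1}^n are identified with subsets of {0..<n}.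
  A Boolean function f : {0,1}^n -> {0,1} is given as a predicate on sets;
  only its values on subsets of {0..<n} matter.\<close>

definition cube :: "nat \<Rightarrow> nat set set" where
  "cube n = Pow {0..<n}"

definition pweight :: "real \<Rightarrow> nat \<Rightarrow> nat set \<Rightarrow> real" where
  "pweight p n A = p ^ card A * (1 - p) ^ (n - card A)"

definition bval :: "bool \<Rightarrow> real" where
  "bval b = (if b then 1 else 0)"

definition mu :: "real \<Rightarrow> nat \<Rightarrow> (nat set \<Rightarrow> bool) \<Rightarrow> real" where
  "mu p n f = (\<Sum>A\<in>cube n. pweight p n A * bval (f A))"

definition intersecting :: "nat \<Rightarrow> (nat set \<Rightarrow> bool) \<Rightarrow> bool" where
  "intersecting n f \<longleftrightarrow>
     (\<forall>A\<in>cube n. \<forall>B\<in>cube n. f A \<and> f B \<longrightarrow> A \<inter> B \<noteq> {})"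

definition chi :: "real \<Rightarrow> nat \<Rightarrow> nat set \<Rightarrow> real" where
  "chi p i A = (bval (i \<in> A) - p) / sqrt (p * (1 - p))"

definition fourier1 :: "real \<Rightarrow> nat \<Rightarrow> (nat set \<Rightarrow> bool) \<Rightarrow> nat \<Rightarrow> real" where
  "fourier1 p n f i = (\<Sum>A\<in>cube n. pweight p n A * (bval (f A) * chi p i A))"

definition delta :: "real \<Rightarrow> nat \<Rightarrow> (nat set \<Rightarrow> bool) \<Rightarrow> real" where
  "delta p n f = Max ((\<lambda>i. \<bar>fourier1 p n f i\<bar>) ` {0..<n})"

definition mval :: "real \<Rightarrow> nat \<Rightarrow> (nat set \<Rightarrow> bool) \<Rightarrow> nat" where
  "mval p n f = card {i\<in>{0..<n}. (fourier1 p n f i)\<^sup>2 \<ge> (delta p n f)\<^sup>2 / 2}"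

end

theory Submission
  imports Defs
begin

text \<open>Let \<open>\<nu>\<close> be \<open>\<mu>\<^sub>p\<close> conditioned on \<open>f\<close>; its entropy relative to \<open>\<mu>\<^sub>p\<close> is
  \<open>- ln (mu p n f)\<close>. If that is below \<open>0.0001 / p\<close>, superadditivity of entropy and the
  hypothesis on \<open>m(f)\<close> force all marginals of \<open>\<nu>\<close> to be at most \<open>3 p\<close>.

  Now reveal two sets \<open>A\<close>, \<open>B\<close> of law \<open>\<nu>\<close> coordinate by coordinate. As long as both
  conditional probabilities are light (at most \<open>8 p\<close>) the bits can be coupled disjointly; at
  the other, heavy, coordinates they are drawn independently. The total heavy probability is at
  most the entropy, so the heavy-light conflicts have expectation \<open>O(p)\<close> times the entropy.
  The heavy-heavy conflicts would obey the same bound under independence because of the small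
  marginals, and the disjoint coupling of light bits changes their expectation only by
  \<open>O(p)\<close> times a variance, which is again at most the entropy. Hence \<open>A\<close> and \<open>B\<close> are
  disjoint with positive probability, so \<open>f\<close> is not intersecting.\<close>

text \<open>Division by zero makes this 0 if \<open>mu p (Suc n) f = 0\<close>, so the bounds 0 and
  1 hold for every \<open>f\<close>.\<close>

definition cond_prob :: "real \<Rightarrow> nat \<Rightarrow> (nat set \<Rightarrow> bool) \<Rightarrow> real" where
  "cond_prob p n f = p * mu p n (\<lambda>A. f (insert n A)) / mu p (Suc n) f"

definition marginal :: "real \<Rightarrow> nat \<Rightarrow> (nat set \<Rightarrow> bool) \<Rightarrow> nat \<Rightarrow> real" where
  "marginal p n f i = mu p n (\<lambda>A. i \<in> A \<and> f A) / mu p n f"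

text \<open>The coordinates are revealed downwards, from \<open>n - 1\<close> to \<open>0\<close>. With \<open>q\<^sub>i\<close> the
  conditional probability of \<open>i \<in> A\<close> given the coordinates above \<open>i\<close>, \<open>excess p t n f i\<close> is
  the expectation of \<open>q\<^sub>i\<close> over the event \<open>q\<^sub>i > t\<close>.\<close>

primrec excess :: "real \<Rightarrow> real \<Rightarrow> nat \<Rightarrow> (nat set \<Rightarrow> bool) \<Rightarrow> nat \<Rightarrow> real" where
  "excess p t 0 f i = 0"
| "excess p t (Suc n) f i =
    (if i = n then (if cond_prob p n f > t then cond_prob p n f else 0)
     else cond_prob p n f * excess p t n (\<lambda>A. f (insert n A)) i
       + (1 - cond_prob p n f) * excess p t n f i)"

text \<open>The linear term pays for heavy-light conflicts; its factor 2 leaves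
  \<open>t * (x + y)\<close> over once \<open>x\<^sup>2 \<le> x\<close> and
  \<open>y\<^sup>2 \<le> y\<close> absorb the squares.\<close>

definition quad :: "real \<Rightarrow> real \<Rightarrow> real \<Rightarrow> real" where
  "quad t x y = 2 * t * (x + y) + x * y - t * x\<^sup>2 - t * y\<^sup>2"

text \<open>An upper bound for the expected number of conflicts in the coupling. The product of the
  excesses counts the heavy-heavy conflicts; the negative squares make the potential
  a supermartingale in spite of the correlations that the coupling creates.\<close>

definition potential ::
    "real \<Rightarrow> real \<Rightarrow> nat \<Rightarrow> (nat set \<Rightarrow> bool) \<Rightarrow> (nat set \<Rightarrow> bool) \<Rightarrow> real" where
  "potential p t n f g = (\<Sum>i<n. quad t (excess p t n f i) (excess p t n g i))"

section \<open>Splitting the cube along its last coordinate\<close>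

lemma sum_cube_Suc:
  fixes h :: "nat set \<Rightarrow> real"
  shows "(\<Sum>A\<in>cube (Suc n). h A) = (\<Sum>A\<in>cube n. h A) + (\<Sum>A\<in>cube n. h (insert n A))"
proof -
  have inj: "inj_on (insert n) (cube n)"
    unfolding cube_def
    by (rule inj_onI) (metis PowD atLeastLessThan_iff insert_ident less_irrefl subsetD)
  have "cube (Suc n) = cube n \<union> insert n ` cube n"
    by (simp add: cube_def atLeast0_lessThan_Suc Pow_insert)
  moreover have "cube n \<inter> insert n ` cube n = {}"
    by (auto simp: cube_def)
  moreover have "finite (cube n)"
    by (simp add: cube_def)
  ultimately show ?thesis
    by (simp add: sum.union_disjoint sum.reindex[OF inj])
qed

lemma cube_memberD:
  assumes "A \<in> cube n"
  shows "finite A" "n \<notin> A" "card A \<le> n"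
proof -
  have "A \<subseteq> {0..<n}"
    using assms by (simp add: cube_def)
  then show "finite A" "n \<notin> A" "card A \<le> n"
    using card_mono[of "{0..<n}" A] finite_subset by auto
qed

lemma mu_Suc:
  "mu p (Suc n) f = (1 - p) * mu p n f + p * mu p n (\<lambda>A. f (insert n A))"
  unfolding mu_def sum_cube_Suc sum_distrib_left
  by (intro arg_cong2[of _ _ _ _ "(+)"] sum.cong)
    (auto simp: pweight_def cube_memberD Suc_diff_le)

lemma mu_0: "mu p 0 f = bval (f {})"
  by (simp add: mu_def cube_def pweight_def)

lemma mu_cong:
  assumes "\<And>A. A \<in> cube n \<Longrightarrow> f A = g A"
  shows "mu p n f = mu p n g"
  unfolding mu_def using assms by (intro sum.cong) auto

section \<open>Inequalities for the quadratic form\<close>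

lemma quad_nonneg:
  assumes "0 \<le> t" "0 \<le> x" "x \<le> 1" "0 \<le> y" "y \<le> 1"
  shows "0 \<le> quad t x y"
proof -
  have "x\<^sup>2 \<le> x" "y\<^sup>2 \<le> y"
    using assms by (auto simp: power2_eq_square mult_left_le)
  then have "t * x\<^sup>2 \<le> t * x" "t * y\<^sup>2 \<le> t * y"
    using assms by (auto intro: mult_left_mono)
  moreover have "0 \<le> x * y" "0 \<le> t * x" "0 \<le> t * y"
    using assms by auto
  ultimately show ?thesis
    unfolding quad_def by (simp add: algebra_simps)
qed

text \<open>Independent bits conflict with probability \<open>q * r\<close>, which the coordinate's
  own term must cover. If both are heavy, the product term does it; if only one is, the other is at
  most \<open>t\<close> and the linear term does.\<close>

lemma quad_truncated_ge:
  assumes "0 \<le> t" "0 \<le> q" "q \<le> 1" "0 \<le> r" "r \<le> 1" "t < q \<or> t < r"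
  shows "q * r \<le> quad t (if t < q then q else 0) (if t < r then r else 0)"
proof -
  have *: "t * s\<^sup>2 \<le> t * s" if "0 \<le> s" "s \<le> 1" for s
    using that assms by (auto simp: power2_eq_square mult_left_le intro!: mult_left_mono)
  have "q * r \<le> q * t" if "r \<le> t"
    using that assms by (intro mult_left_mono) auto
  moreover have "q * r \<le> r * t" if "q \<le> t"
    using that assms mult_right_mono[of q t r] by (simp add: mult.commute)
  moreover have "0 \<le> q * t" "0 \<le> r * t"
    using assms by auto
  ultimately show ?thesis
    using *[OF assms(2,3)] *[OF assms(4,5)] assms(6) unfolding quad_def
    by (cases "t < q"; cases "t < r") (auto simp: algebra_simps)
qed

text \<open>The supermartingale step for the two couplings of bits with expectations \<open>q\<close> and \<open>r\<close>;
  the index of \<open>x\<close> and \<open>y\<close> is the value of the revealed bit.\<close>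

lemma quad_independent:
  assumes "0 \<le> q" "q \<le> 1" "0 \<le> r" "r \<le> 1" "0 \<le> t"
  shows "q * r * quad t x1 y1 + q * (1 - r) * quad t x1 y0
      + (1 - q) * r * quad t x0 y1 + (1 - q) * (1 - r) * quad t x0 y0
    \<le> quad t (q * x1 + (1 - q) * x0) (r * y1 + (1 - r) * y0)"
proof -
  \<comment> \<open>This is exactly the gap between the two sides: \<open>t\<close> times the
    variances, since independence preserves the mean of the product.\<close>
  have "0 \<le> t * (q * (1 - q)) * (x1 - x0)\<^sup>2 + t * (r * (1 - r)) * (y1 - y0)\<^sup>2"
    using assms by auto
  then show ?thesis
    unfolding quad_def by (simp add: algebra_simps power2_eq_square)
qed

lemma quad_disjoint:
  assumes "0 \<le> q" "q \<le> t" "0 \<le> r" "r \<le> t" "t \<le> 1 / 2"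
  shows "q * quad t x1 y0 + r * quad t x0 y1 + (1 - q - r) * quad t x0 y0
    \<le> quad t (q * x1 + (1 - q) * x0) (r * y1 + (1 - r) * y0)"
proof -
  have *: "s\<^sup>2 / 2 \<le> t * (s * (1 - s))" if "0 \<le> s" "s \<le> t" for s
  proof -
    have "s * (1/2) \<le> t * (1 - s)"
      using that assms by (intro mult_mono) auto
    then have "s * (s * (1/2)) \<le> s * (t * (1 - s))"
      using that by (intro mult_left_mono) auto
    then show ?thesis by (simp add: power2_eq_square algebra_simps)
  qed
  define u v where "u = x1 - x0" and "v = y1 - y0"
  \<comment> \<open>Disjoint bits have covariance \<open>- q * r\<close>, so the gap also contains
    \<open>q * r * u * v\<close>. If negative, it is absorbed by the variances after completing the
    square.\<close>
  have "0 \<le> (q * u + r * v)\<^sup>2 / 2"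
    by simp
  also have "\<dots> = q * r * u * v + q\<^sup>2 / 2 * u\<^sup>2 + r\<^sup>2 / 2 * v\<^sup>2"
    by (simp add: power2_eq_square field_simps)
  also have "\<dots> \<le> q * r * u * v + t * (q * (1 - q)) * u\<^sup>2 + t * (r * (1 - r)) * v\<^sup>2"
    using *[of q] *[of r] assms by (intro add_mono mult_right_mono order_refl zero_le_power2)
  finally show ?thesis
    unfolding quad_def u_def v_def by (simp add: algebra_simps power2_eq_square)
qed

section \<open>Conditional probabilities, marginals and entropy\<close>

context
  fixes p :: real
  assumes p: "0 < p" "p < 1"
begin

lemma mu_nonneg: "0 \<le> mu p n f"
  unfolding mu_def using p by (intro sum_nonneg) (auto simp: pweight_def bval_def)

lemma mu_mono:
  assumes "\<And>A. f A \<Longrightarrow> g A"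
  shows "mu p n f \<le> mu p n g"
  unfolding mu_def using p assms by (intro sum_mono) (auto simp: pweight_def bval_def)

lemma mu_le_1: "mu p n f \<le> 1"
proof (induction n arbitrary: f)
  case 0
  then show ?case by (simp add: mu_0 bval_def)
next
  case (Suc n)
  have "(1 - p) * mu p n f + p * mu p n (\<lambda>A. f (insert n A)) \<le> (1 - p) * 1 + p * 1"
    using p Suc by (intro add_mono mult_left_mono) auto
  then show ?case by (simp add: mu_Suc)
qed

lemma cond_prob_nonneg: "0 \<le> cond_prob p n f"
  unfolding cond_prob_def using p mu_nonneg by auto

lemma cond_prob_le_1: "cond_prob p n f \<le> 1"
proof -
  have "p * mu p n (\<lambda>A. f (insert n A)) \<le> mu p (Suc n) f"
    using p mu_nonneg[of n f] by (simp add: mu_Suc)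
  then show ?thesis
    unfolding cond_prob_def using mu_nonneg[of "Suc n" f]
    by (cases "mu p (Suc n) f = 0") (auto simp: divide_le_eq)
qed

lemma one_minus_cond_prob:
  assumes "0 < mu p (Suc n) f"
  shows "1 - cond_prob p n f = (1 - p) * mu p n f / mu p (Suc n) f"
  using assms unfolding cond_prob_def by (simp add: mu_Suc field_simps)

lemma mu_insert_pos:
  assumes "0 < cond_prob p n f"
  shows "0 < mu p n (\<lambda>A. f (insert n A))"
  using assms mu_nonneg[of n "\<lambda>A. f (insert n A)"]
  by (auto simp: cond_prob_def less_le)

lemma mu_keep_pos:
  assumes "0 < mu p (Suc n) f" "cond_prob p n f < 1"
  shows "0 < mu p n f"
  using one_minus_cond_prob[OF assms(1)] assms(2) mu_nonneg[of n f]
  by (auto simp: less_le)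

lemma marginal_Suc:
  assumes "0 < mu p (Suc n) f" "i < n"
  shows "marginal p (Suc n) f i =
    cond_prob p n f * marginal p n (\<lambda>A. f (insert n A)) i
      + (1 - cond_prob p n f) * marginal p n f i"
proof -
  \<comment> \<open>A null branch has an undefined marginal, but it enters with weight 0 on both
    sides.\<close>
  have zero: "mu p n (\<lambda>A. i \<in> A \<and> g A) = 0" if "mu p n g = 0" for g
    using mu_mono[of "\<lambda>A. i \<in> A \<and> g A" g n] mu_nonneg[of n "\<lambda>A. i \<in> A \<and> g A"] that by auto
  have "cond_prob p n f * marginal p n (\<lambda>A. f (insert n A)) i
      = p * mu p n (\<lambda>A. i \<in> A \<and> f (insert n A)) / mu p (Suc n) f"
    using zero[of "\<lambda>A. f (insert n A)"]
    by (cases "mu p n (\<lambda>A. f (insert n A)) = 0") (auto simp: cond_prob_def marginal_def)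
  moreover have "(1 - cond_prob p n f) * marginal p n f i
      = (1 - p) * mu p n (\<lambda>A. i \<in> A \<and> f A) / mu p (Suc n) f"
    unfolding one_minus_cond_prob[OF assms(1)]
    using zero[of f] by (cases "mu p n f = 0") (auto simp: marginal_def)
  moreover have "mu p (Suc n) (\<lambda>A. i \<in> A \<and> f A)
      = (1 - p) * mu p n (\<lambda>A. i \<in> A \<and> f A) + p * mu p n (\<lambda>A. i \<in> A \<and> f (insert n A))"
    using assms(2) by (simp add: mu_Suc)
  ultimately show ?thesis
    unfolding marginal_def[of p "Suc n"] by (simp add: add_divide_distrib)
qed

lemma marginal_last: "marginal p (Suc n) f n = cond_prob p n f"
proof -
  have "mu p n (\<lambda>A. n \<in> A \<and> f A) = mu p n (\<lambda>A. False)"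
    by (intro mu_cong) (auto simp: cube_memberD)
  also have "\<dots> = 0"
    by (simp add: mu_def bval_def)
  finally show ?thesis
    by (simp add: marginal_def cond_prob_def mu_Suc[of p n "\<lambda>A. n \<in> A \<and> f A"])
qed

lemma marginal_nonneg: "0 \<le> marginal p n f i"
  unfolding marginal_def using mu_nonneg by simp

text \<open>The chain rule for the entropy of the conditioned measure relative to the product
  measure, with the second half of the binary divergence estimated by
  \<open>(1 - q) ln ((1 - q) / (1 - p)) \<ge> p - q\<close>.\<close>

lemma entropy_step:
  assumes pos: "0 < mu p (Suc n) f"
    and a: "0 < mu p n (\<lambda>A. f (insert n A)) \<Longrightarrow> a \<le> - ln (mu p n (\<lambda>A. f (insert n A)))"
    and b: "0 < mu p n f \<Longrightarrow> b \<le> - ln (mu p n f)"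
    and q_def: "q = cond_prob p n f"
  shows "(l * q - p * (exp l - 1)) + (q * a + (1 - q) * b) \<le> - ln (mu p (Suc n) f)"
proof -
  define m where "m = mu p (Suc n) f"
  \<comment> \<open>In essence \<open>x * ln (x / w) \<ge> x - w\<close>. Taking
    \<open>w = p * exp l\<close> brings in the free slope \<open>l\<close>; \<open>w = 1 - p\<close>
    handles the absent bit.\<close>
  have aux: "x * y \<le> x * z + (w - x)" if "0 \<le> x" "0 < w" "0 < x \<Longrightarrow> y \<le> z + ln w - ln x" for x y z w :: real
  proof (cases "x = 0")
    case False
    then have x: "0 < x" using that by simp
    have "ln w - ln x \<le> w / x - 1"
      using ln_le_minus_one[of "w / x"] x that by (simp add: ln_div)
    then have "x * y \<le> x * (z + (w / x - 1))"
      using that(3)[OF x] x by (intro mult_left_mono) auto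
    also have "\<dots> = x * z + (w - x)"
      using x by (simp add: distrib_left right_diff_distrib)
    finally show ?thesis .
  qed (use that in auto)
  have m: "0 < m" using pos m_def by simp
  have q01: "0 \<le> q" "q \<le> 1"
    using cond_prob_nonneg cond_prob_le_1 q_def by auto
  have "q * (a + l) \<le> q * (- ln m) + (p * exp l - q)"
  proof (rule aux)
    assume "0 < q"
    then have f1: "0 < mu p n (\<lambda>A. f (insert n A))"
      using mu_insert_pos q_def by blast
    have "q = p * mu p n (\<lambda>A. f (insert n A)) / m"
      by (simp add: q_def cond_prob_def m_def)
    then have "ln q = ln p + ln (mu p n (\<lambda>A. f (insert n A))) - ln m"
      using f1 m p by (simp add: ln_div ln_mult)
    then show "a + l \<le> - ln m + ln (p * exp l) - ln q"
      using a[OF f1] p by (simp add: ln_mult)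
  qed (use q01 p in auto)
  moreover have "(1 - q) * b \<le> (1 - q) * (- ln m) + ((1 - p) - (1 - q))"
  proof (rule aux)
    assume "0 < 1 - q"
    then have f0: "0 < mu p n f"
      using mu_keep_pos[OF pos] q_def by simp
    have "1 - q = (1 - p) * mu p n f / m"
      using one_minus_cond_prob[OF pos] by (simp add: q_def m_def)
    then have "ln (1 - q) = ln (1 - p) + ln (mu p n f) - ln m"
      using f0 m p by (simp add: ln_div ln_mult)
    then show "b \<le> - ln m + ln (1 - p) - ln (1 - q)"
      using b[OF f0] by simp
  qed (use q01 p in auto)
  ultimately show ?thesis
    unfolding m_def[symmetric] by (simp add: algebra_simps)
qed

text \<open>Superadditivity of entropy in dual form: each divergence is replaced by a lower bound
  affine in the marginal, which averages exactly over the revealed bits. The slopes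
  \<open>l i\<close> are free.\<close>

lemma entropy_ge_marginals:
  assumes "0 < mu p n f"
  shows "(\<Sum>i<n. l i * marginal p n f i - p * (exp (l i) - 1)) \<le> - ln (mu p n f)"
  using assms
proof (induction n arbitrary: f)
  case 0
  then show ?case using mu_le_1[of 0 f] by simp
next
  case (Suc n)
  let ?f1 = "\<lambda>A. f (insert n A)" and ?q = "cond_prob p n f"
  let ?s = "\<lambda>f. \<Sum>i<n. l i * marginal p n f i - p * (exp (l i) - 1)"
  have "(\<Sum>i<n. l i * marginal p (Suc n) f i - p * (exp (l i) - 1)) = ?q * ?s ?f1 + (1 - ?q) * ?s f"
    unfolding sum_distrib_left sum.distrib[symmetric]
    by (intro sum.cong) (auto simp: marginal_Suc[OF Suc.prems] algebra_simps)
  then show ?case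
    using entropy_step[OF Suc.prems Suc.IH Suc.IH refl, of "l n"] by (simp add: marginal_last)
qed

section \<open>Total probability at heavy coordinates\<close>

lemma excess_nonneg:
  assumes "0 \<le> t"
  shows "0 \<le> excess p t n f i"
  using assms cond_prob_nonneg cond_prob_le_1
  by (induction n arbitrary: f) auto

lemma excess_le_1:
  assumes "0 \<le> t"
  shows "excess p t n f i \<le> 1"
proof (induction n arbitrary: f)
  case (Suc n)
  show ?case
    using convex_bound_le[OF Suc Suc, of "cond_prob p n f" "1 - cond_prob p n f"]
      cond_prob_nonneg[of n f] cond_prob_le_1[of n f] by auto
qed simp

text \<open>Without the truncation, the conditional probabilities average to the marginal.\<close>

lemma excess_le_marginal:
  assumes "0 < mu p n f" "i < n"
  shows "excess p t n f i \<le> marginal p n f i"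
  using assms
proof (induction n arbitrary: f)
  case (Suc n)
  let ?f1 = "\<lambda>A. f (insert n A)" and ?q = "cond_prob p n f"
  show ?case
  proof (cases "i = n")
    case True
    then show ?thesis using cond_prob_nonneg by (simp add: marginal_last)
  next
    case False
    then have i: "i < n" using Suc.prems by simp
    have "?q * excess p t n ?f1 i \<le> ?q * marginal p n ?f1 i"
      using Suc.IH[OF mu_insert_pos i] cond_prob_nonneg[of n f]
      by (cases "?q = 0") (auto intro: mult_left_mono)
    moreover have "(1 - ?q) * excess p t n f i \<le> (1 - ?q) * marginal p n f i"
      using Suc.IH[OF mu_keep_pos[OF Suc.prems(1)] i] cond_prob_le_1[of n f]
      by (cases "?q = 1") (auto intro: mult_left_mono)
    ultimately show ?thesis
      using False by (simp add: marginal_Suc[OF Suc.prems(1) i])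
  qed
qed simp

lemma sum_excess_Suc:
  "(\<Sum>i<Suc n. excess p t (Suc n) f i) =
    (if cond_prob p n f > t then cond_prob p n f else 0)
    + (cond_prob p n f * (\<Sum>i<n. excess p t n (\<lambda>A. f (insert n A)) i)
       + (1 - cond_prob p n f) * (\<Sum>i<n. excess p t n f i))"
  by (simp add: sum_distrib_left sum.distrib)

text \<open>Slope 2 at a heavy coordinate yields \<open>2 * q - p * (exp 2 - 1) \<ge> q\<close>,
  because \<open>exp 2 - 1 \<le> 8\<close> and \<open>q > 8 * p\<close>; slope 0 at a light one
  yields 0.\<close>

lemma sum_excess_le_entropy:
  assumes "0 < mu p n f"
  shows "(\<Sum>i<n. excess p (8 * p) n f i) \<le> - ln (mu p n f)"
  using assms
proof (induction n arbitrary: f)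
  case 0
  then show ?case using mu_le_1[of 0 f] by simp
next
  case (Suc n)
  let ?q = "cond_prob p n f"
  have "exp (2::real) = exp 1 ^ 2"
    by (simp flip: exp_of_nat_mult)
  also have "\<dots> \<le> (3::real) ^ 2"
    using exp_le by (intro power_mono) auto
  finally have "exp 2 - 1 \<le> (8::real)"
    by (simp add: power2_eq_square)
  then have "p * (exp 2 - 1) \<le> p * 8"
    using p by (intro mult_left_mono) auto
  then have "(if ?q > 8 * p then ?q else 0) \<le> max (2 * ?q - p * (exp 2 - 1)) (0 * ?q - p * (exp 0 - 1))"
    by auto
  then show ?case
    unfolding sum_excess_Suc
    using entropy_step[OF Suc.prems Suc.IH Suc.IH refl, of 2]
      entropy_step[OF Suc.prems Suc.IH Suc.IH refl, of 0]
    by linarith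
qed

section \<open>The coupling and its potential\<close>

lemma potential_nonneg:
  assumes "0 \<le> t"
  shows "0 \<le> potential p t n f g"
  unfolding potential_def
  using assms excess_nonneg excess_le_1 by (intro sum_nonneg quad_nonneg) auto

lemma potential_Suc:
  "potential p t (Suc n) f g =
    quad t (if t < cond_prob p n f then cond_prob p n f else 0)
      (if t < cond_prob p n g then cond_prob p n g else 0)
    + (\<Sum>i<n. quad t
        (cond_prob p n f * excess p t n (\<lambda>A. f (insert n A)) i
          + (1 - cond_prob p n f) * excess p t n f i)
        (cond_prob p n g * excess p t n (\<lambda>A. g (insert n A)) i
          + (1 - cond_prob p n g) * excess p t n g i))"
  unfolding potential_def by simp

text \<open>The coupling is run as an induction: without a disjoint pair, every conflict-free branch
  of positive weight has potential at least 1, and the supermartingale step carries this bound back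
  to the root.\<close>

lemma exists_disjoint_members:
  assumes "0 \<le> t" "t \<le> 1 / 2"
    and "0 < mu p n f" "0 < mu p n g" "potential p t n f g < 1"
  shows "\<exists>A\<in>cube n. \<exists>B\<in>cube n. f A \<and> g B \<and> A \<inter> B = {}"
  using assms(3-)
proof (induction n arbitrary: f g)
  case 0
  then show ?case by (auto simp: mu_0 bval_def cube_def split: if_splits)
next
  case (Suc n)
  define f1 g1 where "f1 = (\<lambda>A. f (insert n A))" and "g1 = (\<lambda>A. g (insert n A))"
  define q r where "q = cond_prob p n f" and "r = cond_prob p n g"
  define e where "e = quad t (if t < q then q else 0) (if t < r then r else 0)"
  let ?P = "potential p t n"
  have qr: "0 \<le> q" "q \<le> 1" "0 \<le> r" "r \<le> 1"
    using cond_prob_nonneg cond_prob_le_1 by (auto simp: q_def r_def)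
  have pos: "0 < q \<Longrightarrow> 0 < mu p n f1" "q < 1 \<Longrightarrow> 0 < mu p n f"
    "0 < r \<Longrightarrow> 0 < mu p n g1" "r < 1 \<Longrightarrow> 0 < mu p n g"
    using mu_insert_pos mu_keep_pos Suc.prems by (auto simp: q_def r_def f1_def g1_def)
  have up: "cube n \<subseteq> cube (Suc n)" "A \<in> cube n \<Longrightarrow> insert n A \<in> cube (Suc n)" for A
    by (auto simp: cube_def)
  show ?case
  proof (rule ccontr)
    assume none: "\<not> ?case"
    have none0: "A \<inter> B \<noteq> {}" if "A \<in> cube (Suc n)" "B \<in> cube (Suc n)" "f A" "g B" for A B
      using none that by blast
    have P00: "1 \<le> ?P f g" if h: "q < 1" "r < 1"
    proof (rule ccontr)
      assume "\<not> 1 \<le> ?P f g"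
      then obtain A B where "A \<in> cube n" "B \<in> cube n" "f A" "g B" "A \<inter> B = {}"
        using Suc.IH[OF pos(2)[OF h(1)] pos(4)[OF h(2)]] by auto
      then show False using none0[of A B] up by blast
    qed
    have P10: "1 \<le> ?P f1 g" if h: "0 < q" "r < 1"
    proof (rule ccontr)
      assume "\<not> 1 \<le> ?P f1 g"
      then obtain A B where "A \<in> cube n" "B \<in> cube n" "f1 A" "g B" "A \<inter> B = {}"
        using Suc.IH[OF pos(1)[OF h(1)] pos(4)[OF h(2)]] by auto
      then show False using none0[of "insert n A" B] up cube_memberD(2) by (auto simp: f1_def)
    qed
    have P01: "1 \<le> ?P f g1" if h: "q < 1" "0 < r"
    proof (rule ccontr)
      assume "\<not> 1 \<le> ?P f g1"
      then obtain A B where "A \<in> cube n" "B \<in> cube n" "f A" "g1 B" "A \<inter> B = {}"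
        using Suc.IH[OF pos(2)[OF h(1)] pos(3)[OF h(2)]] by auto
      then show False using none0[of A "insert n B"] up cube_memberD(2) by (auto simp: g1_def)
    qed
    have weighted: "w \<le> w * x" if "0 \<le> w" "0 < w \<Longrightarrow> 1 \<le> x" for w x :: real
      using that by (cases "w = 0") auto
    have "1 \<le> potential p t (Suc n) f g"
    proof (cases "t < q \<or> t < r")
      case True
      have "q * (1 - r) \<le> q * (1 - r) * ?P f1 g"
        using qr P10 by (intro weighted) (auto simp: zero_less_mult_iff)
      moreover have "(1 - q) * r \<le> (1 - q) * r * ?P f g1"
        using qr P01 by (intro weighted) (auto simp: zero_less_mult_iff)
      moreover have "(1 - q) * (1 - r) \<le> (1 - q) * (1 - r) * ?P f g"
        using qr P00 by (intro weighted) (auto simp: zero_less_mult_iff)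
      \<comment> \<open>The branch with both bits 1 is a conflict; its weight is charged to
        \<open>e\<close>.\<close>
      moreover have "0 \<le> q * r * ?P f1 g1"
        using qr potential_nonneg assms by auto
      moreover have "q * r \<le> e"
        unfolding e_def using quad_truncated_ge True qr assms by blast
      moreover have "q * r * ?P f1 g1 + q * (1 - r) * ?P f1 g + (1 - q) * r * ?P f g1
          + (1 - q) * (1 - r) * ?P f g \<le> potential p t (Suc n) f g - e"
        unfolding potential_Suc q_def[symmetric] r_def[symmetric] f1_def[symmetric]
          g1_def[symmetric] e_def[symmetric]
        unfolding potential_def sum_distrib_left sum.distrib[symmetric]
        using qr assms by (auto intro!: sum_mono quad_independent)
      moreover have "q * r + q * (1 - r) + (1 - q) * r + (1 - q) * (1 - r) = 1"
        by (simp add: algebra_simps)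
      ultimately show ?thesis by linarith
    next
      case False
      \<comment> \<open>Both bits are light: the disjoint coupling has branches of weight
        \<open>q\<close>, \<open>r\<close> and \<open>1 - q - r\<close>, where
        \<open>t \<le> 1 / 2\<close> keeps the last one nonnegative.\<close>
      have "q \<le> q * ?P f1 g"
        using qr P10 False assms by (intro weighted) auto
      moreover have "r \<le> r * ?P f g1"
        using qr P01 False assms by (intro weighted) auto
      moreover have "1 - q - r \<le> (1 - q - r) * ?P f g"
        using qr P00 False assms by (intro weighted) auto
      moreover have "e = 0"
        using False by (simp add: e_def quad_def)
      moreover have "q * ?P f1 g + r * ?P f g1 + (1 - q - r) * ?P f g
          \<le> potential p t (Suc n) f g - e"
        unfolding potential_Suc q_def[symmetric] r_def[symmetric] f1_def[symmetric]
          g1_def[symmetric] e_def[symmetric]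
        unfolding potential_def sum_distrib_left sum.distrib[symmetric]
        using qr False assms by (auto intro!: sum_mono quad_disjoint)
      ultimately show ?thesis by linarith
    qed
    then show False using Suc.prems by simp
  qed
qed

text \<open>With \<open>t = 8 * p\<close> the linear term is \<open>32 * p * x\<close>, and
  \<open>x \<le> 3 * p\<close> bounds the product by \<open>3 * p * x\<close>, whence 35. The bound
  \<open>p \<le> 1 / 16\<close> gives \<open>t \<le> 1 / 2\<close>.\<close>

lemma intersecting_mu_bound:
  assumes "p \<le> 1 / 16" and f: "intersecting n f" "0 < mu p n f"
    and marg: "\<And>i. i < n \<Longrightarrow> marginal p n f i \<le> 3 * p"
  shows "1 \<le> 35 * p * - ln (mu p n f)"
proof (rule ccontr)
  assume neg: "\<not> ?thesis"
  let ?x = "excess p (8 * p) n f"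
  have "potential p (8 * p) n f f \<le> (\<Sum>i<n. 35 * p * ?x i)"
    unfolding potential_def
  proof (intro sum_mono)
    fix i assume "i \<in> {..<n}"
    then have "?x i \<le> 3 * p"
      using excess_le_marginal[OF f(2)] marg by (meson lessThan_iff order_trans)
    moreover have x0: "0 \<le> ?x i"
      using p by (intro excess_nonneg) auto
    ultimately have "?x i * ?x i \<le> 3 * p * ?x i"
      by (intro mult_right_mono)
    moreover have "0 \<le> p * (?x i * ?x i)"
      using p x0 by simp
    ultimately show "quad (8 * p) (?x i) (?x i) \<le> 35 * p * ?x i"
      by (simp add: quad_def power2_eq_square)
  qed
  also have "\<dots> = 35 * p * (\<Sum>i<n. ?x i)"
    by (simp add: sum_distrib_left)
  also have "\<dots> \<le> 35 * p * - ln (mu p n f)"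
    using sum_excess_le_entropy[OF f(2)] p by (intro mult_left_mono) auto
  finally have "potential p (8 * p) n f f < 1"
    using neg by linarith
  then show False
    using exists_disjoint_members[of "8 * p" n f f] assms p
    by (auto simp: intersecting_def)
qed

section \<open>From Fourier coefficients to marginals\<close>

lemma fourier1_marginal:
  assumes "0 < mu p n f"
  shows "fourier1 p n f i = mu p n f / sqrt (p * (1 - p)) * (marginal p n f i - p)"
proof -
  have "fourier1 p n f i = (mu p n (\<lambda>A. i \<in> A \<and> f A) - p * mu p n f) / sqrt (p * (1 - p))"
    unfolding fourier1_def mu_def sum_distrib_left sum_subtractf[symmetric] sum_divide_distrib
    by (intro sum.cong) (auto simp: bval_def chi_def field_simps)
  also have "mu p n (\<lambda>A. i \<in> A \<and> f A) - p * mu p n f = mu p n f * (marginal p n f i - p)"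
    using assms by (simp add: marginal_def right_diff_distrib)
  finally show ?thesis by simp
qed

text \<open>One marginal above \<open>3 * p\<close> would force all marginals in \<open>J\<close> to
  be at least \<open>12 / 5 * p\<close>. Each then costs entropy at least \<open>2 * p / 5\<close>,
  and there are at least \<open>1 / p\<^sup>2\<close> of them.\<close>

lemma marginal_le:
  assumes pos: "0 < mu p n f" and m: "1 / sqrt (real (mval p n f)) \<le> p"
    and small: "- ln (mu p n f) < 2 / (5 * p)" and i: "i < n"
  shows "marginal p n f i \<le> 3 * p"
proof (rule ccontr)
  assume big: "\<not> ?thesis"
  define c where "c = mu p n f / sqrt (p * (1 - p))"
  define J where "J = {j\<in>{0..<n}. (fourier1 p n f j)\<^sup>2 \<ge> (delta p n f)\<^sup>2 / 2}"
  have c: "0 < c" using pos p by (simp add: c_def)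
  have J: "finite J" "J \<subseteq> {..<n}" by (auto simp: J_def)
  have "delta p n f \<in> (\<lambda>i. \<bar>fourier1 p n f i\<bar>) ` {0..<n}"
    unfolding delta_def using i by (intro Max_in) auto
  then obtain k where k: "k < n" "delta p n f = \<bar>fourier1 p n f k\<bar>" by auto
  have delta: "\<bar>fourier1 p n f i\<bar> \<le> delta p n f"
    unfolding delta_def using i by (intro Max_ge) auto
  \<comment> \<open>The maximizer makes \<open>J\<close> nonempty, which excludes the default value
    \<open>1 / sqrt 0 = 0\<close> in the hypothesis on \<open>mval\<close>.\<close>
  have "k \<in> J" using k by (simp add: J_def)
  then have "0 < card J" using J by (auto simp: card_gt_0_iff)
  then have "1 / p \<le> sqrt (real (card J))"
    using m[unfolded mval_def, folded J_def] p by (simp add: field_simps)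
  then have "(1 / p)\<^sup>2 \<le> (sqrt (real (card J)))\<^sup>2"
    using p by (intro power_mono) auto
  then have card: "1 / p\<^sup>2 \<le> real (card J)"
    by (simp add: power_divide)
  have margJ: "2 * p / 5 \<le> marginal p n f j - 2 * p" if "j \<in> J" for j
  proof -
    have "(fourier1 p n f i)\<^sup>2 \<le> (delta p n f)\<^sup>2"
      using delta power_mono[of "\<bar>fourier1 p n f i\<bar>" "delta p n f" 2] by simp
    also have "\<dots> \<le> 2 * (fourier1 p n f j)\<^sup>2"
      using that by (simp add: J_def)
    finally have "c\<^sup>2 * (marginal p n f i - p)\<^sup>2 \<le> c\<^sup>2 * (2 * (marginal p n f j - p)\<^sup>2)"
      by (simp add: fourier1_marginal[OF pos] c_def[symmetric] power_mult_distrib)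
    then have "(marginal p n f i - p)\<^sup>2 \<le> 2 * (marginal p n f j - p)\<^sup>2"
      using c by simp
    moreover have "(2 * p)\<^sup>2 \<le> (marginal p n f i - p)\<^sup>2"
      using big p by (intro power_mono) auto
    \<comment> \<open>\<open>7 / 5\<close> is below \<open>sqrt 2\<close> and above 1: a deviation
      larger than \<open>p\<close> must be upwards, as marginals are nonnegative.\<close>
    moreover have "2 * (7 / 5 * p)\<^sup>2 \<le> (2 * p)\<^sup>2"
      by (simp add: power2_eq_square)
    ultimately have "(7 / 5 * p)\<^sup>2 \<le> \<bar>marginal p n f j - p\<bar>\<^sup>2"
      by simp
    then have "7 / 5 * p \<le> \<bar>marginal p n f j - p\<bar>"
      by (rule power2_le_imp_le) simp
    then show ?thesis
      using marginal_nonneg[of n f j] p by linarith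
  qed
  have "exp 1 - 1 \<le> (2::real)"
    using exp_le by simp
  then have e: "p * (exp 1 - 1) \<le> 2 * p"
    using p mult_left_mono[of "exp 1 - 1" 2 p] by simp
  have "2 / (5 * p) = 1 / p\<^sup>2 * (2 * p / 5)"
    using p by (simp add: power2_eq_square)
  also have "\<dots> \<le> real (card J) * (2 * p / 5)"
    using card p by (intro mult_right_mono) auto
  also have "\<dots> \<le> (\<Sum>j\<in>J. marginal p n f j - p * (exp 1 - 1))"
    using margJ e by (intro sum_bounded_below) fastforce
  \<comment> \<open>The slopes are the indicator of \<open>J\<close>.\<close>
  also have "\<dots> = (\<Sum>j<n. of_bool (j \<in> J) * marginal p n f j - p * (exp (of_bool (j \<in> J)) - 1))"
    using J by (intro sum.mono_neutral_cong_left) auto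
  also have "\<dots> \<le> - ln (mu p n f)"
    by (rule entropy_ge_marginals[OF pos])
  finally show False using small by simp
qed

end

theorem mainTheorem14:
  fixes n :: nat and p :: real and f :: "nat set \<Rightarrow> bool"
  assumes "0 < p"
    and "intersecting n f"
    and "1 / sqrt (real (mval p n f)) \<le> p"
    and "p \<le> 1 / 2"
  shows "mu p n f \<le> 32 * exp (- 0.0001 / p)"
proof (rule ccontr)
  assume neg: "\<not> ?thesis"
  have p: "0 < p" "p < 1" using assms by auto
  define c E where "c = 1 / (10000 * p)" and "E = exp (- c)"
  have c: "- 0.0001 / p = - c" by (simp add: c_def)
  have big: "32 * E < mu p n f"
    using neg unfolding c E_def by simp
  have E: "0 < E" "1 - c \<le> E"
    using exp_ge_add_one_self[of "- c"] by (auto simp: E_def)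
  have pos: "0 < mu p n f"
    using big E by linarith
  \<comment> \<open>For larger \<open>p\<close> the claimed bound exceeds 1:
    \<open>c \<le> 1 / 2\<close> gives \<open>32 * E \<ge> 16\<close>.\<close>
  have p16: "p \<le> 1 / 16"
  proof (rule ccontr)
    assume "\<not> p \<le> 1 / 16"
    then have "c \<le> 1 / 2" using p by (simp add: c_def divide_le_eq)
    then show False using big E mu_le_1[OF p, of n f] by linarith
  qed
  have "E < mu p n f"
    using big E by linarith
  then have "ln E < ln (mu p n f)"
    using E pos by (subst ln_less_cancel_iff) auto
  then have entropy: "- ln (mu p n f) < c"
    by (simp add: E_def)
  also have "c \<le> 2 / (5 * p)"
    using p by (simp add: c_def divide_le_eq)
  finally have "marginal p n f i \<le> 3 * p" if "i < n" for i
    using marginal_le[OF p pos assms(3)] that by blast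
  then have "1 \<le> 35 * p * - ln (mu p n f)"
    by (rule intersecting_mu_bound[OF p p16 assms(2) pos])
  also have "\<dots> \<le> 35 * p * c"
    using entropy p by (intro mult_left_mono) auto
  \<comment> \<open>The product is \<open>35 / 10000\<close>.\<close>
  also have "\<dots> < 1"
    using p by (simp add: c_def)
  finally show False by simp
qed

end
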